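(* Let $H$ be a finite Heyting algebra. For any $N\in Heymod_H$, the functor $-\otimes_H N:Heymod_H\to Heymod_H$ is left adjoint to the functor $Heymod_H(N,-):Heymod_H\to Heymod_H$.
   Context: Lattices have all finite meets and joins (hence a least element $0$ and a greatest element $1$). A join semilattice is a poset in which every finite subset, including the empty one, has a join; its least element is $0$. For a distributive lattice $L$, a distributive module over $L$ is a join semilattice $M$ with an action $L\times M\to M$, $(x,m)\mapsto x\wedge m$, order preserving in both variables, such that $1\wedge m=m$, $0\wedge m=0$, $(x\wedge y)\wedge m=x\wedge(y\wedge m)$, $(x\vee y)\wedge m=(x\wedge m)\vee(y\wedge m)$, $x\wedge(m\vee n)=(x\wedge m)\vee(x\wedge n)$. Morphisms are maps preserving finite joins (including $0$) and satisfying $g(x\wedge m)=x\wedge g(m)$. A Heyting algebra $H$ is a lattice such that for all $y,z\in H$ there is $(y\to z)_H\in H$ with $x\wedge y\le z\Leftrightarrow x\le (y\to z)_H$ for all $x\in H$. A Heyting module over $H$ is a distributive module $M$ over $H$ such that for all $m,n\in M$ there is $(m\to n)_M\in H$ with $x\wedge m\le n\Leftrightarrow x\le(m\to n)_M$ for all $x\in H$; morphisms are morphisms of distributive modules. $Heymod_H$ is the resulting category. When $H$ is finite, every distributive module over $H$ is a Heyting module. For $M,N\in Heymod_H$, the set $Heymod_H(M,N)$ of morphisms is a Heyting module via $(f\vee g)(m)=f(m)\vee g(m)$ and $(c\wedge f)(m)=c\wedge f(m)$. Tensor product: for a set $S$, $Free_H(S)$ is the set of functions $S\to H$ of finite support with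 pointwise $\vee$ and pointwise action of $H$; its elements are written as formal finite sums (joins) $\sum c_i\wedge s_i$, $c_i\in H$, $s_i\in S$. $M\otimes_H N$ is the quotient of $Free_H(M\times N)$ by the equivalence relation generated by the following, where $u=\sum c_i\wedge(m_i,n_i)$ is arbitrary, $c,d\in H$, $m,m'\in M$, $n,n'\in N$: $u+c\wedge(0,n)\sim u\sim u+c\wedge(m,0)$; $u+c\wedge(m,n)+c\wedge(m',n)\sim u+c\wedge(m\vee m',n)$; $u+c\wedge(m,n)+c\wedge(m,n')\sim u+c\wedge(m,n\vee n')$; $u+c\wedge(d\wedge m,n)\sim u+(c\wedge d)\wedge(m,n)\sim u+c\wedge(m,d\wedge n)$. The operations of $Free_H(M\times N)$ descend to make $M\otimes_H N$ a Heyting module over $H$; $m\otimes n$ denotes the class of $(m,n)$. A morphism $g:M\to M'$ induces $g\otimes_H N$ by $m\otimes n\mapsto g(m)\otimes n$. *)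

theory Defs
  imports Main "HOL-Library.FuncSet"
begin

class heyting_algebra = bounded_lattice +
  assumes heyting_implication: "\<exists>w. \<forall>x. inf x y \<le> z \<longleftrightarrow> x \<le> w"
begin

subclass distrib_lattice
proof
  fix x y z :: 'a
  have meet_join: "inf a (sup b c) \<le> sup (inf a b) (inf a c)" for a b c :: 'a
  proof -
    obtain w where w: "\<And>x. inf x a \<le> sup (inf a b) (inf a c) \<longleftrightarrow> x \<le> w"
      using heyting_implication by blast
    have "b \<le> w" "c \<le> w"
      using w[of b] w[of c] by (simp_all add: inf_commute)
    then have "sup b c \<le> w" by simp
    then show ?thesis using w[of "sup b c"] by (simp add: inf_commute)
  qed
  have "inf a (sup b c) = sup (inf a b) (inf a c)" for a b c :: 'a
    by (rule order.antisym[OF meet_join]) (simp add: le_infI2)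
  then show "sup x (inf y z) = inf (sup x y) (sup x z)"
    by (rule distrib_imp1)
qed

end

text \<open>
  Modules are carried by subsets of a type. The order of the underlying join semilattice is
  recovered from binary joins, see \<open>mod_le\<close>; the locale below requires it to be a partial
  order for which \<open>join\<close> and \<open>bottom\<close> really are the joins of pairs and of the empty set.
\<close>

record ('h, 'm) hmod =
  carrier :: "'m set"
  bottom :: 'm
  join :: "'m \<Rightarrow> 'm \<Rightarrow> 'm"
  act :: "'h \<Rightarrow> 'm \<Rightarrow> 'm"

definition mod_le :: "('h, 'm) hmod \<Rightarrow> 'm \<Rightarrow> 'm \<Rightarrow> bool" where
  "mod_le M m n \<longleftrightarrow> join M m n = n"

definition is_join :: "('h, 'm) hmod \<Rightarrow> 'm set \<Rightarrow> 'm \<Rightarrow> bool" where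
  "is_join M A s \<longleftrightarrow> s \<in> carrier M \<and> (\<forall>a\<in>A. mod_le M a s) \<and>
     (\<forall>t\<in>carrier M. (\<forall>a\<in>A. mod_le M a t) \<longrightarrow> mod_le M s t)"

locale join_semilattice =
  fixes M :: "('h, 'm) hmod"
  assumes le_refl: "m \<in> carrier M \<Longrightarrow> mod_le M m m"
    and le_antisym: "m \<in> carrier M \<Longrightarrow> n \<in> carrier M \<Longrightarrow>
      mod_le M m n \<Longrightarrow> mod_le M n m \<Longrightarrow> m = n"
    and le_trans: "m \<in> carrier M \<Longrightarrow> n \<in> carrier M \<Longrightarrow> p \<in> carrier M \<Longrightarrow>
      mod_le M m n \<Longrightarrow> mod_le M n p \<Longrightarrow> mod_le M m p"
    and finite_joins: "finite A \<Longrightarrow> A \<subseteq> carrier M \<Longrightarrow> \<exists>s. is_join M A s"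
    and bottom_is_join: "is_join M {} (bottom M)"
    and join_is_join: "m \<in> carrier M \<Longrightarrow> n \<in> carrier M \<Longrightarrow> is_join M {m, n} (join M m n)"

locale distributive_module = join_semilattice M
  for M :: "('h :: {distrib_lattice, bounded_lattice}, 'm) hmod" +
  assumes act_closed: "m \<in> carrier M \<Longrightarrow> act M x m \<in> carrier M"
    and act_mono_left: "m \<in> carrier M \<Longrightarrow> x \<le> y \<Longrightarrow> mod_le M (act M x m) (act M y m)"
    and act_mono_right: "m \<in> carrier M \<Longrightarrow> n \<in> carrier M \<Longrightarrow> mod_le M m n \<Longrightarrow>
      mod_le M (act M x m) (act M x n)"
    and act_top: "m \<in> carrier M \<Longrightarrow> act M top m = m"
    and act_bot: "m \<in> carrier M \<Longrightarrow> act M bot m = bottom M"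
    and act_inf: "m \<in> carrier M \<Longrightarrow> act M (inf x y) m = act M x (act M y m)"
    and act_sup: "m \<in> carrier M \<Longrightarrow> act M (sup x y) m = join M (act M x m) (act M y m)"
    and act_join: "m \<in> carrier M \<Longrightarrow> n \<in> carrier M \<Longrightarrow>
      act M x (join M m n) = join M (act M x m) (act M x n)"

locale heyting_module = distributive_module M
  for M :: "('h :: heyting_algebra, 'm) hmod" +
  assumes module_implication: "m \<in> carrier M \<Longrightarrow> n \<in> carrier M \<Longrightarrow>
    \<exists>w. \<forall>x. mod_le M (act M x m) n \<longleftrightarrow> x \<le> w"

text \<open>
  Morphisms are extensional functions, so that equality of morphisms is equality in HOL.
  Accordingly composition is \<^const>\<open>compose\<close> and the identity is \<open>\<lambda>m\<in>carrier M. m\<close>.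
\<close>

definition heymod_hom :: "('h, 'm) hmod \<Rightarrow> ('h, 'n) hmod \<Rightarrow> ('m \<Rightarrow> 'n) set" where
  "heymod_hom M N = {g \<in> carrier M \<rightarrow>\<^sub>E carrier N.
     g (bottom M) = bottom N \<and>
     (\<forall>m\<in>carrier M. \<forall>n\<in>carrier M. g (join M m n) = join N (g m) (g n)) \<and>
     (\<forall>x. \<forall>m\<in>carrier M. g (act M x m) = act N x (g m))}"

definition hom_module :: "('h, 'm) hmod \<Rightarrow> ('h, 'n) hmod \<Rightarrow> ('h, 'm \<Rightarrow> 'n) hmod" where
  "hom_module M N =
     \<lparr>carrier = heymod_hom M N,
      bottom = (\<lambda>m\<in>carrier M. bottom N),
      join = (\<lambda>f g. \<lambda>m\<in>carrier M. join N (f m) (g m)),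
      act = (\<lambda>c f. \<lambda>m\<in>carrier M. act N c (f m))\<rparr>"

definition hom_map :: "('h, 'n) hmod \<Rightarrow> ('h, 'p) hmod \<Rightarrow> ('p \<Rightarrow> 'q) \<Rightarrow> ('n \<Rightarrow> 'p) \<Rightarrow> ('n \<Rightarrow> 'q)" where
  "hom_map N P g = (\<lambda>f\<in>heymod_hom N P. compose (carrier N) g f)"

text \<open>Functions on \<open>S\<close> are represented by functions on the whole type that are \<open>bot\<close> off \<open>S\<close>.\<close>

definition free_module :: "'s set \<Rightarrow> ('h :: bounded_lattice, 's \<Rightarrow> 'h) hmod" where
  "free_module S =
     \<lparr>carrier = {u. finite {s. u s \<noteq> bot} \<and> {s. u s \<noteq> bot} \<subseteq> S},
      bottom = (\<lambda>s. bot),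
      join = (\<lambda>u v s. sup (u s) (v s)),
      act = (\<lambda>c u s. inf c (u s))\<rparr>"

text \<open>\<open>free_single c s\<close> is the formal term \<open>c \<and> s\<close>, and \<open>add_term u c s\<close> is \<open>u + c \<and> s\<close>.\<close>

definition free_single :: "'h \<Rightarrow> 's \<Rightarrow> 's \<Rightarrow> 'h :: bounded_lattice" where
  "free_single c s = (\<lambda>t. if t = s then c else bot)"

definition add_term :: "('s \<Rightarrow> 'h :: bounded_lattice) \<Rightarrow> 'h \<Rightarrow> 's \<Rightarrow> 's \<Rightarrow> 'h" where
  "add_term u c s = (\<lambda>t. sup (u t) (free_single c s t))"

inductive tensor_step ::
  "('h :: bounded_lattice, 'm) hmod \<Rightarrow> ('h, 'n) hmod \<Rightarrow> ('m \<times> 'n \<Rightarrow> 'h) \<Rightarrow> ('m \<times> 'n \<Rightarrow> 'h) \<Rightarrow> bool"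
  for M :: "('h, 'm) hmod" and N :: "('h, 'n) hmod" where
  bottom_left: "\<lbrakk>u \<in> carrier (free_module (carrier M \<times> carrier N)); n \<in> carrier N\<rbrakk> \<Longrightarrow>
    tensor_step M N (add_term u c (bottom M, n)) u"
| bottom_right: "\<lbrakk>u \<in> carrier (free_module (carrier M \<times> carrier N)); m \<in> carrier M\<rbrakk> \<Longrightarrow>
    tensor_step M N u (add_term u c (m, bottom N))"
| join_left: "\<lbrakk>u \<in> carrier (free_module (carrier M \<times> carrier N));
      m \<in> carrier M; m' \<in> carrier M; n \<in> carrier N\<rbrakk> \<Longrightarrow>
    tensor_step M N (add_term (add_term u c (m, n)) c (m', n)) (add_term u c (join M m m', n))"
| join_right: "\<lbrakk>u \<in> carrier (free_module (carrier M \<times> carrier N));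
      m \<in> carrier M; n \<in> carrier N; n' \<in> carrier N\<rbrakk> \<Longrightarrow>
    tensor_step M N (add_term (add_term u c (m, n)) c (m, n')) (add_term u c (m, join N n n'))"
| act_left: "\<lbrakk>u \<in> carrier (free_module (carrier M \<times> carrier N)); m \<in> carrier M; n \<in> carrier N\<rbrakk> \<Longrightarrow>
    tensor_step M N (add_term u c (act M d m, n)) (add_term u (inf c d) (m, n))"
| act_right: "\<lbrakk>u \<in> carrier (free_module (carrier M \<times> carrier N)); m \<in> carrier M; n \<in> carrier N\<rbrakk> \<Longrightarrow>
    tensor_step M N (add_term u (inf c d) (m, n)) (add_term u c (m, act N d n))"

definition tensor_class ::
  "('h :: bounded_lattice, 'm) hmod \<Rightarrow> ('h, 'n) hmod \<Rightarrow> ('m \<times> 'n \<Rightarrow> 'h) \<Rightarrow> ('m \<times> 'n \<Rightarrow> 'h) set" where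
  "tensor_class M N u =
     {v \<in> carrier (free_module (carrier M \<times> carrier N)). equivclp (tensor_step M N) u v}"

text \<open>
  The unions below run over all choices of representatives; the resulting class does not
  depend on the choice, so each union is a single equivalence class.
\<close>

definition tensor ::
  "('h :: bounded_lattice, 'm) hmod \<Rightarrow> ('h, 'n) hmod \<Rightarrow> ('h, ('m \<times> 'n \<Rightarrow> 'h) set) hmod" where
  "tensor M N = (let F = free_module (carrier M \<times> carrier N) in
     \<lparr>carrier = tensor_class M N ` carrier F,
      bottom = tensor_class M N (bottom F),
      join = (\<lambda>X Y. \<Union>u\<in>X. \<Union>v\<in>Y. tensor_class M N (join F u v)),
      act = (\<lambda>c X. \<Union>u\<in>X. tensor_class M N (act F c u))\<rparr>)"

definition pure_tensor ::
  "('h :: bounded_lattice, 'm) hmod \<Rightarrow> ('h, 'n) hmod \<Rightarrow> 'm \<Rightarrow> 'n \<Rightarrow> ('m \<times> 'n \<Rightarrow> 'h) set" where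
  "pure_tensor M N m n = tensor_class M N (free_single top (m, n))"

text \<open>The morphism induced by \<open>m \<otimes> n \<mapsto> g m \<otimes> n\<close>.\<close>

definition tensor_map ::
  "('h :: bounded_lattice, 'n) hmod \<Rightarrow> ('h, 'm) hmod \<Rightarrow> ('h, 'k) hmod \<Rightarrow> ('m \<Rightarrow> 'k) \<Rightarrow>
   ('m \<times> 'n \<Rightarrow> 'h) set \<Rightarrow> ('k \<times> 'n \<Rightarrow> 'h) set" where
  "tensor_map N M M' g = (THE h. h \<in> heymod_hom (tensor M N) (tensor M' N) \<and>
     (\<forall>m\<in>carrier M. \<forall>n\<in>carrier N. h (pure_tensor M N m n) = pure_tensor M' N (g m) n))"

definition tensor_curry ::
  "('h :: bounded_lattice, 'm) hmod \<Rightarrow> ('h, 'n) hmod \<Rightarrow> (('m \<times> 'n \<Rightarrow> 'h) set \<Rightarrow> 'p) \<Rightarrow> 'm \<Rightarrow> 'n \<Rightarrow> 'p" where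
  "tensor_curry M N f = (\<lambda>m\<in>carrier M. \<lambda>n\<in>carrier N. f (pure_tensor M N m n))"

end

(* A morphism from M to Hom(N, P) is the same as a map on pairs (m, n) that respects the relations
   generating the tensor product. Such a map b extends to formal sums by sending u to the join of
   the elements u(m, n) \<and> b(m, n). Upper bounds of this finite join are described pairwise, so
   invariance under each generating relation is immediate, and the extension descends to the tensor
   product. It is unique because pure tensors generate. Functoriality and naturality then follow
   from comparing morphisms on pure tensors. *)
theory Submission
  imports Defs
begin

section \<open>Distributive modules by equations\<close>

text \<open>Finiteness of \<open>H\<close> enters through \<open>finite_heyting_module\<close>,
  which supplies the implications of the tensor product and of the module of morphisms. Everything
  else takes place in distributive modules, whose laws are equations and so can be checked pointwise
  or on representatives. The obstacle is the extension of \<open>b\<close> to formal sums.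
  \<open>finite_joins\<close> provides a join only as an element characterised by its upper bounds,
  so identities between such joins are proved by comparing upper bounds. Terms with coefficient
  \<open>bot\<close> contribute the bottom element and equal terms merge by idempotence, so supports
  need no bookkeeping. The action is the exception: upper bounds of \<open>act P c p\<close> are not
  described by those of \<open>p\<close>, and compatibility with the action needs induction on
  formal sums.\<close>

context join_semilattice
begin

lemma bottom_closed: "bottom M \<in> carrier M"
  using bottom_is_join by (simp add: is_join_def)

lemma bottom_le: "m \<in> carrier M \<Longrightarrow> mod_le M (bottom M) m"
  using bottom_is_join by (simp add: is_join_def)

lemma join_closed: "m \<in> carrier M \<Longrightarrow> n \<in> carrier M \<Longrightarrow> join M m n \<in> carrier M"
  using join_is_join by (simp add: is_join_def)

lemma join_le_iff:
  assumes "m \<in> carrier M" "n \<in> carrier M" "t \<in> carrier M"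
  shows "mod_le M (join M m n) t \<longleftrightarrow> mod_le M m t \<and> mod_le M n t"
proof -
  have "mod_le M m (join M m n)" "mod_le M n (join M m n)"
    "mod_le M m t \<Longrightarrow> mod_le M n t \<Longrightarrow> mod_le M (join M m n) t"
    using join_is_join[OF assms(1,2)] assms(3) by (simp_all add: is_join_def)
  then show ?thesis using le_trans join_closed assms by meson
qed

text \<open>Taking \<open>t\<close> to be \<open>n\<close> and then \<open>m\<close> gives both
  inequalities. With \<open>join_le_iff\<close>, this reduces join identities to propositional
  logic.\<close>

lemma eq_iff_upper_bounds:
  assumes "m \<in> carrier M" "n \<in> carrier M"
    and "\<And>t. t \<in> carrier M \<Longrightarrow> mod_le M m t \<longleftrightarrow> mod_le M n t"
  shows "m = n"
  using assms le_antisym le_refl by blast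

lemma join_assoc:
  "\<lbrakk>m \<in> carrier M; n \<in> carrier M; p \<in> carrier M\<rbrakk> \<Longrightarrow>
    join M (join M m n) p = join M m (join M n p)"
  by (rule eq_iff_upper_bounds) (auto simp: join_closed join_le_iff)

lemma join_commute:
  "\<lbrakk>m \<in> carrier M; n \<in> carrier M\<rbrakk> \<Longrightarrow> join M m n = join M n m"
  by (rule eq_iff_upper_bounds) (auto simp: join_closed join_le_iff)

lemma join_left_commute:
  "\<lbrakk>m \<in> carrier M; n \<in> carrier M; p \<in> carrier M\<rbrakk> \<Longrightarrow>
    join M m (join M n p) = join M n (join M m p)"
  by (rule eq_iff_upper_bounds) (auto simp: join_closed join_le_iff)

lemma join_idem: "m \<in> carrier M \<Longrightarrow> join M m m = m"
  using le_refl by (simp add: mod_le_def)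

lemma join_bottom_left: "m \<in> carrier M \<Longrightarrow> join M (bottom M) m = m"
  using bottom_le by (simp add: mod_le_def)

end

context distributive_module
begin

text \<open>The bottom element is \<open>bot\<close> acting on itself, and \<open>inf x bot\<close>
  is \<open>bot\<close>.\<close>

lemma act_bottom: "act M x (bottom M) = bottom M"
  using act_inf[OF bottom_closed, of x bot] act_bot[OF bottom_closed] by simp

lemma act_act_commute:
  "m \<in> carrier M \<Longrightarrow> act M x (act M y m) = act M y (act M x m)"
  using act_inf[of m x y] act_inf[of m y x] by (simp add: inf_commute)

end

text \<open>A commutative idempotent monoid determines its order and its finite joins, and
  monotonicity of the action follows from its two distributive laws. The modules built below can
  therefore be verified by equations alone, without describing their order.\<close>

lemma distributive_moduleI:
  fixes M :: "('h :: {distrib_lattice, bounded_lattice}, 'm) hmod"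
  assumes bottom: "bottom M \<in> carrier M"
    and join: "\<And>m n. m \<in> carrier M \<Longrightarrow> n \<in> carrier M \<Longrightarrow> join M m n \<in> carrier M"
    and act: "\<And>x m. m \<in> carrier M \<Longrightarrow> act M x m \<in> carrier M"
    and assoc: "\<And>m n p. m \<in> carrier M \<Longrightarrow> n \<in> carrier M \<Longrightarrow> p \<in> carrier M \<Longrightarrow>
      join M (join M m n) p = join M m (join M n p)"
    and commute: "\<And>m n. m \<in> carrier M \<Longrightarrow> n \<in> carrier M \<Longrightarrow> join M m n = join M n m"
    and idem: "\<And>m. m \<in> carrier M \<Longrightarrow> join M m m = m"
    and unit: "\<And>m. m \<in> carrier M \<Longrightarrow> join M (bottom M) m = m"
    and top: "\<And>m. m \<in> carrier M \<Longrightarrow> act M top m = m"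
    and bot: "\<And>m. m \<in> carrier M \<Longrightarrow> act M bot m = bottom M"
    and inf: "\<And>x y m. m \<in> carrier M \<Longrightarrow> act M (inf x y) m = act M x (act M y m)"
    and sup: "\<And>x y m. m \<in> carrier M \<Longrightarrow> act M (sup x y) m = join M (act M x m) (act M y m)"
    and act_join: "\<And>x m n. m \<in> carrier M \<Longrightarrow> n \<in> carrier M \<Longrightarrow>
      act M x (join M m n) = join M (act M x m) (act M x n)"
  shows "distributive_module M"
proof -
  have is_join2: "is_join M {m, n} (join M m n)" if m: "m \<in> carrier M" and n: "n \<in> carrier M" for m n
  proof -
    have "join M m (join M m n) = join M m n" if "m \<in> carrier M" "n \<in> carrier M" for m n
      using assoc[OF that(1,1,2)] idem[OF that(1)] by simp
    from this[OF m n] this[OF n m]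
    have "join M m (join M m n) = join M m n" "join M n (join M m n) = join M m n"
      by (simp_all add: commute[OF n m])
    moreover have "join M (join M m n) t = t"
      if "t \<in> carrier M" "join M m t = t" "join M n t = t" for t
      using assoc[OF m n that(1)] that by simp
    ultimately show ?thesis by (simp add: is_join_def mod_le_def join m n)
  qed
  have trans: "mod_le M m p"
    if "m \<in> carrier M" "n \<in> carrier M" "p \<in> carrier M" "mod_le M m n" "mod_le M n p" for m n p
    using assoc[OF that(1-3)] that(4,5) by (simp add: mod_le_def)
  show ?thesis
  proof
    fix A :: "'m set"
    assume "finite A" "A \<subseteq> carrier M"
    then show "\<exists>s. is_join M A s"
    proof (induction A rule: finite_induct)
      case empty
      then show ?case using bottom unit by (auto simp: is_join_def mod_le_def)
    next
      case (insert a A)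
      then obtain s where s: "is_join M A s" by auto
      then have sc: "s \<in> carrier M" and ac: "a \<in> carrier M"
        using insert.prems by (auto simp: is_join_def)
      have "is_join M (insert a A) (join M a s)"
        using s is_join2[OF ac sc] insert.prems trans[of _ s "join M a s"]
        unfolding is_join_def by auto
      then show ?case ..
    qed
  next
    fix m n :: 'm assume "m \<in> carrier M" "n \<in> carrier M" "mod_le M m n" "mod_le M n m"
    then show "m = n" using commute[of m n] by (simp add: mod_le_def)
  next
    fix m :: 'm and x y :: 'h assume "m \<in> carrier M" "x \<le> y"
    then show "mod_le M (act M x m) (act M y m)"
      using sup[of m x y] by (simp add: mod_le_def sup_absorb2)
  next
    fix m n x assume "m \<in> carrier M" "n \<in> carrier M" "mod_le M m n"
    then show "mod_le M (act M x m) (act M x n)"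
      using act_join[of m n x] by (simp add: mod_le_def)
  qed (fact trans is_join2 act top bot inf sup act_join
      | simp add: is_join_def mod_le_def bottom idem unit)+
qed

text \<open>The implication is the join of all \<open>x\<close> with
  \<open>mod_le M (act M x m) n\<close>. This finite set contains \<open>bot\<close> and, by
  \<open>act_sup\<close>, is closed under binary joins, so its join belongs to it; monotonicity of
  the action makes it downward closed.\<close>

lemma finite_heyting_module:
  fixes M :: "('h :: {finite, heyting_algebra}, 'm) hmod"
  assumes "distributive_module M"
  shows "heyting_module M"
proof -
  interpret distributive_module M by fact
  show ?thesis
  proof
    fix m n assume m: "m \<in> carrier M" and n: "n \<in> carrier M"
    let ?A = "{x. mod_le M (act M x m) n}"
    let ?w = "Sup_fin ?A"
    have bot: "bot \<in> ?A" using m n by (simp add: act_bot bottom_le)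
    have closed: "Sup_fin B \<in> ?A" if "finite B" "B \<noteq> {}" "B \<subseteq> ?A" for B
      using that
      by (induction B rule: finite_ne_induct) (auto simp: m n act_sup act_closed join_le_iff)
    have "?A \<noteq> {}" using bot by blast
    then have "?w \<in> ?A" by (intro closed) simp_all
    moreover have "mod_le M (act M x m) n" if "x \<le> ?w" "?w \<in> ?A" for x
      using le_trans[OF act_closed[OF m] act_closed[OF m] n act_mono_left[OF m that(1)]] that(2) by simp
    moreover have "x \<le> ?w" if "x \<in> ?A" for x
      using that by (simp add: Sup_fin.coboundedI)
    ultimately show "\<exists>w. \<forall>x. mod_le M (act M x m) n \<longleftrightarrow> x \<le> w" by blast
  qed
qed

section \<open>Modules of morphisms\<close>

lemma heymod_homI:
  assumes "g \<in> carrier M \<rightarrow>\<^sub>E carrier N" "g (bottom M) = bottom N"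
    and "\<And>m n. m \<in> carrier M \<Longrightarrow> n \<in> carrier M \<Longrightarrow> g (join M m n) = join N (g m) (g n)"
    and "\<And>x m. m \<in> carrier M \<Longrightarrow> g (act M x m) = act N x (g m)"
  shows "g \<in> heymod_hom M N"
  using assms by (simp add: heymod_hom_def)

lemma heymod_homD:
  assumes "g \<in> heymod_hom M N"
  shows "g \<in> carrier M \<rightarrow>\<^sub>E carrier N"
    and "g \<in> extensional (carrier M)"
    and "m \<in> carrier M \<Longrightarrow> g m \<in> carrier N"
    and "g (bottom M) = bottom N"
    and "m \<in> carrier M \<Longrightarrow> n \<in> carrier M \<Longrightarrow> g (join M m n) = join N (g m) (g n)"
    and "m \<in> carrier M \<Longrightarrow> g (act M x m) = act N x (g m)"
  using assms by (auto simp: heymod_hom_def PiE_def)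

lemma heymod_hom_id:
  assumes "distributive_module M"
  shows "(\<lambda>m\<in>carrier M. m) \<in> heymod_hom M M"
proof -
  interpret distributive_module M by fact
  show ?thesis
    by (rule heymod_homI) (auto simp: bottom_closed join_closed act_closed)
qed

lemma heymod_hom_compose:
  assumes "distributive_module M" "g \<in> heymod_hom M N" "h \<in> heymod_hom N P"
  shows "compose (carrier M) h g \<in> heymod_hom M P"
proof -
  interpret distributive_module M by fact
  show ?thesis
    by (rule heymod_homI)
      (auto simp: compose_def bottom_closed join_closed act_closed
        heymod_homD[OF assms(2)] heymod_homD[OF assms(3)])
qed

lemma hom_module_simps [simp]:
  "carrier (hom_module M N) = heymod_hom M N"
  "bottom (hom_module M N) = (\<lambda>m\<in>carrier M. bottom N)"
  "join (hom_module M N) f g = (\<lambda>m\<in>carrier M. join N (f m) (g m))"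
  "act (hom_module M N) c f = (\<lambda>m\<in>carrier M. act N c (f m))"
  by (simp_all add: hom_module_def)

text \<open>The laws are inherited pointwise from \<open>N\<close>. That a scalar multiple of a
  morphism respects the action rests on \<open>act_act_commute\<close>, that is, on commutativity of
  meets in the lattice of scalars.\<close>

lemma distributive_hom_module:
  assumes "distributive_module M" "distributive_module N"
  shows "distributive_module (hom_module M N)"
proof -
  interpret M: distributive_module M by fact
  interpret N: distributive_module N by fact
  note M = M.bottom_closed M.join_closed M.act_closed
  note N = N.bottom_closed N.join_closed N.act_closed
  \<comment> \<open>A pointwise operation returns a restricted function, so laws such as
    idempotence, which compare it with \<open>f\<close> itself, need extensionality of
    morphisms.\<close>
  have restrict_eq: "(\<lambda>m\<in>carrier M. k m) = f"
    if "f \<in> heymod_hom M N" "\<And>m. m \<in> carrier M \<Longrightarrow> k m = f m" for k f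
    using that by (intro extensionalityI[of _ "carrier M"]) (auto simp: heymod_homD)
  have restrict_cong: "(\<lambda>m\<in>carrier M. k m) = (\<lambda>m\<in>carrier M. l m)"
    if "\<And>m. m \<in> carrier M \<Longrightarrow> k m = l m" for k l :: "_ \<Rightarrow> 'c"
    using that by (intro restrict_ext) auto
  show ?thesis
  proof (rule distributive_moduleI, unfold hom_module_simps)
    show "(\<lambda>m\<in>carrier M. bottom N) \<in> heymod_hom M N"
      by (rule heymod_homI) (auto simp: M N N.join_idem N.act_bottom)
    show "(\<lambda>m\<in>carrier M. join N (f m) (g m)) \<in> heymod_hom M N"
      if "f \<in> heymod_hom M N" "g \<in> heymod_hom M N" for f g
      using that by (intro heymod_homI)
        (auto simp: M N heymod_homD N.join_idem N.act_join N.join_assoc N.join_left_commute)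
    show "(\<lambda>m\<in>carrier M. act N x (f m)) \<in> heymod_hom M N" if "f \<in> heymod_hom M N" for f x
      using that by (intro heymod_homI)
        (auto simp: M N heymod_homD N.act_bottom N.act_join intro: N.act_act_commute)
  qed (auto intro!: restrict_eq restrict_cong simp: N heymod_homD N.join_assoc N.join_idem
      N.join_bottom_left N.act_top N.act_bot N.act_inf N.act_sup N.act_join
      intro: N.join_commute)
qed

lemma hom_map_apply:
  "f \<in> heymod_hom N P \<Longrightarrow> hom_map N P g f = compose (carrier N) g f"
  by (simp add: hom_map_def)

lemma hom_map_hom:
  assumes "distributive_module N" "distributive_module P1" "g \<in> heymod_hom P1 P2"
  shows "hom_map N P1 g \<in> heymod_hom (hom_module N P1) (hom_module N P2)"
proof -
  interpret H: distributive_module "hom_module N P1"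
    by (rule distributive_hom_module) fact+
  note H = H.bottom_closed H.join_closed H.act_closed
  show ?thesis
  proof (rule heymod_homI)
    show "hom_map N P1 g \<in> carrier (hom_module N P1) \<rightarrow>\<^sub>E carrier (hom_module N P2)"
      using heymod_hom_compose[OF assms(1) _ assms(3)] by (auto simp: hom_map_def)
  qed (use H in \<open>auto simp: hom_map_apply compose_def restrict_def fun_eq_iff heymod_homD
      heymod_homD[OF assms(3)]\<close>)
qed

lemma hom_map_id:
  "hom_map N P (\<lambda>p\<in>carrier P. p) = (\<lambda>f\<in>carrier (hom_module N P). f)"
proof (rule extensionalityI[of _ "heymod_hom N P"])
  fix f assume f: "f \<in> heymod_hom N P"
  then have "compose (carrier N) (\<lambda>p\<in>carrier P. p) f = f"
    by (intro extensionalityI[of _ "carrier N"]) (auto simp: compose_def heymod_homD)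
  with f show "hom_map N P (\<lambda>p\<in>carrier P. p) f = (\<lambda>f\<in>carrier (hom_module N P). f) f"
    by (simp add: hom_map_apply)
qed (auto simp: hom_map_def)

lemma hom_map_compose:
  assumes "distributive_module N" "g \<in> heymod_hom P1 P2"
  shows "hom_map N P1 (compose (carrier P1) h g) =
    compose (carrier (hom_module N P1)) (hom_map N P2 h) (hom_map N P1 g)"
proof (rule extensionalityI[of _ "heymod_hom N P1"])
  fix f assume f: "f \<in> heymod_hom N P1"
  then show "hom_map N P1 (compose (carrier P1) h g) f =
    compose (carrier (hom_module N P1)) (hom_map N P2 h) (hom_map N P1 g) f"
    using heymod_hom_compose[OF assms(1) f assms(2)]
    by (auto simp: hom_map_apply compose_eq heymod_homD intro: compose_assoc[symmetric])
qed (auto simp: hom_map_def)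

section \<open>Formal sums\<close>

lemma free_module_simps [simp]:
  "bottom (free_module S) = (\<lambda>s. bot)"
  "join (free_module S) u v = (\<lambda>s. sup (u s) (v s))"
  "act (free_module S) c u = (\<lambda>s. inf c (u s))"
  by (simp_all add: free_module_def)

lemma free_carrier_iff:
  "u \<in> carrier (free_module S) \<longleftrightarrow> finite {s. u s \<noteq> bot} \<and> {s. u s \<noteq> bot} \<subseteq> S"
  by (simp add: free_module_def)

lemma free_bottom_closed: "(\<lambda>s. bot) \<in> carrier (free_module S)"
  by (simp add: free_carrier_iff)

lemma free_join_closed:
  fixes u :: "'s \<Rightarrow> 'h :: bounded_lattice"
  assumes "u \<in> carrier (free_module S)" "v \<in> carrier (free_module S)"
  shows "(\<lambda>s. sup (u s) (v s)) \<in> carrier (free_module S)"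
proof -
  have "{s. sup (u s) (v s) \<noteq> bot} \<subseteq> {s. u s \<noteq> bot} \<union> {s. v s \<noteq> bot}" by auto
  then show ?thesis
    using assms unfolding free_carrier_iff by (meson finite_UnI finite_subset order_trans Un_least)
qed

lemma free_act_closed:
  fixes u :: "'s \<Rightarrow> 'h :: bounded_lattice"
  assumes "u \<in> carrier (free_module S)"
  shows "(\<lambda>s. inf c (u s)) \<in> carrier (free_module S)"
proof -
  have "{s. inf c (u s) \<noteq> bot} \<subseteq> {s. u s \<noteq> bot}" by auto
  then show ?thesis
    using assms unfolding free_carrier_iff by (meson finite_subset order_trans)
qed

lemma free_single_closed: "s \<in> S \<Longrightarrow> free_single c s \<in> carrier (free_module S)"
  unfolding free_carrier_iff free_single_def
  by (auto intro: finite_subset[of _ "{s}"])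

lemma add_term_closed:
  "u \<in> carrier (free_module S) \<Longrightarrow> s \<in> S \<Longrightarrow> add_term u c s \<in> carrier (free_module S)"
  unfolding add_term_def by (intro free_join_closed free_single_closed)

lemma add_term_bot: "add_term (\<lambda>s. bot) c s = free_single c s"
  by (auto simp: add_term_def)

lemma free_induct [consumes 1, case_names bottom add]:
  fixes u :: "'s \<Rightarrow> 'h :: bounded_lattice"
  assumes "u \<in> carrier (free_module S)"
    and bottom: "Q (\<lambda>s. bot)"
    and add: "\<And>u c s. u \<in> carrier (free_module S) \<Longrightarrow> s \<in> S \<Longrightarrow> Q u \<Longrightarrow> Q (add_term u c s)"
  shows "Q u"
proof -
  \<comment> \<open>Induction runs over a finite set that contains the support, so the coefficient
    removed at \<open>a\<close> may itself be \<open>bot\<close>.\<close>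
  have "Q u" if "finite A" "A \<subseteq> S" "{s. u s \<noteq> bot} \<subseteq> A" for A u
    using that
  proof (induction A arbitrary: u rule: finite_induct)
    case empty
    then have "u = (\<lambda>s. bot)" by auto
    then show ?case using bottom by simp
  next
    case (insert a A)
    have supp: "{s. (u(a := bot)) s \<noteq> bot} \<subseteq> A" using insert.prems by auto
    then have "Q (u(a := bot))" using insert by blast
    moreover have "u(a := bot) \<in> carrier (free_module S)"
      using supp insert unfolding free_carrier_iff by (meson finite_subset insert_subset order_trans)
    moreover have "u = add_term (u(a := bot)) (u a) a"
      by (auto simp: add_term_def free_single_def)
    ultimately show ?case using add insert.prems by (metis insert_subset)
  qed
  then show ?thesis using assms(1) unfolding free_carrier_iff by blast
qed

text \<open>Pointwise operations pass through the last term of a sum. Applied to both sides of a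
  generating relation, they give the same relation with a new \<open>u\<close>.\<close>

lemma add_term_join:
  "(\<lambda>t. sup (add_term u c s t) (w t)) = add_term (\<lambda>t. sup (u t) (w t)) c s"
  by (auto simp: add_term_def ac_simps)

lemma add_term_act:
  fixes u :: "'s \<Rightarrow> 'h :: {distrib_lattice, bounded_lattice}"
  shows "(\<lambda>t. inf d (add_term u c s t)) = add_term (\<lambda>t. inf d (u t)) (inf d c) s"
  by (auto simp: add_term_def free_single_def inf_sup_distrib1)

section \<open>The tensor product as a quotient\<close>

lemma equivclp_map:
  assumes "equivclp R a b" "\<And>x y. R x y \<Longrightarrow> R (f x) (f y)"
  shows "equivclp R (f a) (f b)"
  using assms(1)
proof (induction rule: equivclp_induct)
  case (step y z)
  then show ?case using assms(2) by (metis equivclp_into_equivclp)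
qed simp

lemma equivclp_invariant:
  assumes "equivclp R a b" "\<And>x y. R x y \<Longrightarrow> f x = f y"
  shows "f a = f b"
  using assms(1) by (induction rule: equivclp_induct) (auto dest: assms(2))

locale module_pair = M: distributive_module M + N: distributive_module N
  for M :: "('h :: {distrib_lattice, bounded_lattice}, 'm) hmod" and N :: "('h, 'n) hmod"
begin

abbreviation F :: "('h, 'm \<times> 'n \<Rightarrow> 'h) hmod" where
  "F \<equiv> free_module (carrier M \<times> carrier N)"

abbreviation cls :: "('m \<times> 'n \<Rightarrow> 'h) \<Rightarrow> ('m \<times> 'n \<Rightarrow> 'h) set" where
  "cls \<equiv> tensor_class M N"

lemma tensor_step_join:
  assumes "tensor_step M N u v" and w: "w \<in> carrier F"
  shows "tensor_step M N (\<lambda>s. sup (u s) (w s)) (\<lambda>s. sup (v s) (w s))"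
  using assms(1)
  by cases (auto simp: add_term_join intro!: tensor_step.intros free_join_closed w)

lemma tensor_step_act:
  assumes "tensor_step M N u v"
  shows "tensor_step M N (\<lambda>s. inf c (u s)) (\<lambda>s. inf c (v s))"
  using assms
  by cases (auto simp: add_term_act inf_assoc[symmetric] intro!: tensor_step.intros free_act_closed)

section \<open>Operations on equivalence classes\<close>

lemma cls_eq:
  assumes "equivclp (tensor_step M N) u v"
  shows "cls u = cls v"
  unfolding tensor_class_def using assms by (blast intro: equivclp_trans equivclp_sym)

lemma cls_step: "tensor_step M N u v \<Longrightarrow> cls u = cls v"
  by (intro cls_eq) auto

lemma mem_cls_self: "u \<in> carrier F \<Longrightarrow> u \<in> cls u"
  by (simp add: tensor_class_def)

lemma mem_clsD: "v \<in> cls u \<Longrightarrow> v \<in> carrier F \<and> equivclp (tensor_step M N) u v"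
  by (simp add: tensor_class_def)

lemma equiv_join_left:
  assumes "equivclp (tensor_step M N) u v" "w \<in> carrier F"
  shows "equivclp (tensor_step M N) (\<lambda>s. sup (u s) (w s)) (\<lambda>s. sup (v s) (w s))"
  by (rule equivclp_map[where f = "\<lambda>u s. sup (u s) (w s)", OF assms(1)])
    (rule tensor_step_join[OF _ assms(2)])

lemma equiv_act:
  assumes "equivclp (tensor_step M N) u v"
  shows "equivclp (tensor_step M N) (\<lambda>s. inf c (u s)) (\<lambda>s. inf c (v s))"
  by (rule equivclp_map[where f = "\<lambda>u s. inf c (u s)", OF assms]) (rule tensor_step_act)

text \<open>One summand is replaced at a time. The summand held fixed must be a genuine formal sum:
  \<open>u\<close> while \<open>v\<close> changes, then \<open>v'\<close> while \<open>u\<close>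
  changes.\<close>

lemma equiv_join:
  assumes "equivclp (tensor_step M N) u u'" "equivclp (tensor_step M N) v v'"
    and u: "u \<in> carrier F" and v': "v' \<in> carrier F"
  shows "equivclp (tensor_step M N) (\<lambda>s. sup (u s) (v s)) (\<lambda>s. sup (u' s) (v' s))"
proof -
  have "equivclp (tensor_step M N) (\<lambda>s. sup (v s) (u s)) (\<lambda>s. sup (v' s) (u s))"
    using assms(2) u by (rule equiv_join_left)
  moreover have "equivclp (tensor_step M N) (\<lambda>s. sup (u s) (v' s)) (\<lambda>s. sup (u' s) (v' s))"
    using assms(1) v' by (rule equiv_join_left)
  ultimately show ?thesis
    unfolding sup.commute[of "u _"] sup.commute[of "u' _"] by (rule equivclp_trans)
qed

lemma carrier_tensor: "carrier (tensor M N) = cls ` carrier F"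
  by (simp add: tensor_def Let_def)

lemma bottom_tensor: "bottom (tensor M N) = cls (\<lambda>s. bot)"
  by (simp add: tensor_def Let_def)

lemma cls_closed: "u \<in> carrier F \<Longrightarrow> cls u \<in> carrier (tensor M N)"
  by (simp add: carrier_tensor)

lemma join_cls:
  assumes "u \<in> carrier F" "v \<in> carrier F"
  shows "join (tensor M N) (cls u) (cls v) = cls (\<lambda>s. sup (u s) (v s))"
proof -
  have eq: "cls (\<lambda>s. sup (u' s) (v' s)) = cls (\<lambda>s. sup (u s) (v s))"
    if "u' \<in> cls u" "v' \<in> cls v" for u' v'
    using that assms by (intro cls_eq[symmetric] equiv_join) (auto dest: mem_clsD)
  have "join (tensor M N) (cls u) (cls v) =
      (\<Union>u'\<in>cls u. \<Union>v'\<in>cls v. cls (\<lambda>s. sup (u' s) (v' s)))"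
    by (simp add: tensor_def Let_def)
  also have "\<dots> = (\<Union>u'\<in>cls u. \<Union>v'\<in>cls v. cls (\<lambda>s. sup (u s) (v s)))"
    by (intro SUP_cong refl eq)
  \<comment> \<open>A union of a constant family equals its value because the index sets are
    nonempty: \<open>u\<close> and \<open>v\<close> lie in their own classes.\<close>
  also have "\<dots> = cls (\<lambda>s. sup (u s) (v s))"
    using mem_cls_self[OF assms(1)] mem_cls_self[OF assms(2)] by blast
  finally show ?thesis .
qed

lemma act_cls:
  assumes "u \<in> carrier F"
  shows "act (tensor M N) c (cls u) = cls (\<lambda>s. inf c (u s))"
proof -
  have eq: "cls (\<lambda>s. inf c (u' s)) = cls (\<lambda>s. inf c (u s))" if "u' \<in> cls u" for u'
    using mem_clsD[OF that] by (intro cls_eq[symmetric] equiv_act) simp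
  have "act (tensor M N) c (cls u) = (\<Union>u'\<in>cls u. cls (\<lambda>s. inf c (u' s)))"
    by (simp add: tensor_def Let_def)
  also have "\<dots> = (\<Union>u'\<in>cls u. cls (\<lambda>s. inf c (u s)))"
    by (intro SUP_cong refl eq)
  also have "\<dots> = cls (\<lambda>s. inf c (u s))"
    using mem_cls_self[OF assms] by blast
  finally show ?thesis .
qed

lemma distributive_tensor: "distributive_module (tensor M N)"
  by (rule distributive_moduleI)
    (auto simp: carrier_tensor bottom_tensor join_cls act_cls free_bottom_closed free_join_closed
      free_act_closed sup.assoc sup.commute sup.left_commute inf.assoc inf_sup_distrib1
      inf_sup_distrib2)

section \<open>Pure tensors: generation and bilinearity\<close>

lemma pure_tensor_closed:
  "m \<in> carrier M \<Longrightarrow> n \<in> carrier N \<Longrightarrow> pure_tensor M N m n \<in> carrier (tensor M N)"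
  unfolding pure_tensor_def by (intro cls_closed free_single_closed) auto

text \<open>This is how pure tensors generate: together with \<open>free_induct\<close>, it builds
  every class from them by the action and joins.\<close>

lemma cls_add_term:
  assumes "u \<in> carrier F" "m \<in> carrier M" "n \<in> carrier N"
  shows "cls (add_term u c (m, n)) =
    join (tensor M N) (cls u) (act (tensor M N) c (pure_tensor M N m n))"
proof -
  have "free_single top (m, n) \<in> carrier F" using assms by (simp add: free_single_closed)
  moreover have "(\<lambda>s. inf c (free_single top (m, n) s)) = free_single c (m, n)"
    by (auto simp: free_single_def)
  ultimately show ?thesis
    using assms
    by (simp add: pure_tensor_def act_cls join_cls free_single_closed add_term_def)
qed

text \<open>This law and the other bilinearity laws of pure tensors are the generating relations
  with \<open>u\<close> the zero sum and \<open>c\<close> equal to \<open>top\<close>.\<close>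

lemma pure_tensor_bottom_left:
  "n \<in> carrier N \<Longrightarrow> pure_tensor M N (bottom M) n = bottom (tensor M N)"
  using cls_step[OF tensor_step.bottom_left, OF free_bottom_closed, of n top]
  by (simp add: pure_tensor_def bottom_tensor add_term_bot)

lemma pure_tensor_bottom_right:
  "m \<in> carrier M \<Longrightarrow> pure_tensor M N m (bottom N) = bottom (tensor M N)"
  using cls_step[OF tensor_step.bottom_right, OF free_bottom_closed, of m top]
  by (simp add: pure_tensor_def bottom_tensor add_term_bot)

lemma cls_single_pair:
  assumes "s \<in> carrier M \<times> carrier N" "t \<in> carrier M \<times> carrier N"
  shows "cls (add_term (free_single top s) top t) =
    join (tensor M N) (cls (free_single top s)) (cls (free_single top t))"
  using assms by (simp add: join_cls free_single_closed add_term_def)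

lemma pure_tensor_join_left:
  assumes "m \<in> carrier M" "m' \<in> carrier M" "n \<in> carrier N"
  shows "pure_tensor M N (join M m m') n =
    join (tensor M N) (pure_tensor M N m n) (pure_tensor M N m' n)"
  using cls_step[OF tensor_step.join_left, OF free_bottom_closed assms, of top] assms
  by (simp add: pure_tensor_def add_term_bot cls_single_pair)

lemma pure_tensor_join_right:
  assumes "m \<in> carrier M" "n \<in> carrier N" "n' \<in> carrier N"
  shows "pure_tensor M N m (join N n n') =
    join (tensor M N) (pure_tensor M N m n) (pure_tensor M N m n')"
  using cls_step[OF tensor_step.join_right, OF free_bottom_closed assms, of top] assms
  by (simp add: pure_tensor_def add_term_bot cls_single_pair)

lemma act_pure_tensor:
  assumes "m \<in> carrier M" "n \<in> carrier N"
  shows "act (tensor M N) c (pure_tensor M N m n) = cls (free_single c (m, n))"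
proof -
  have "(\<lambda>s. inf c (free_single top (m, n) s)) = free_single c (m, n)"
    by (auto simp: free_single_def)
  then show ?thesis using assms by (simp add: pure_tensor_def act_cls free_single_closed)
qed

lemma pure_tensor_act_left:
  assumes "m \<in> carrier M" "n \<in> carrier N"
  shows "pure_tensor M N (act M d m) n = act (tensor M N) d (pure_tensor M N m n)"
  using cls_step[OF tensor_step.act_left, OF free_bottom_closed assms, of top d] assms
  by (simp add: pure_tensor_def act_pure_tensor[unfolded pure_tensor_def] add_term_bot)

lemma pure_tensor_act_right:
  assumes "m \<in> carrier M" "n \<in> carrier N"
  shows "pure_tensor M N m (act N d n) = act (tensor M N) d (pure_tensor M N m n)"
  using cls_step[OF tensor_step.act_right, OF free_bottom_closed assms, of top d] assms
  by (simp add: pure_tensor_def act_pure_tensor[unfolded pure_tensor_def] add_term_bot)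

lemma tensor_hom_eqI:
  assumes f: "f \<in> heymod_hom (tensor M N) P" and g: "g \<in> heymod_hom (tensor M N) P"
    and eq: "\<And>m n. m \<in> carrier M \<Longrightarrow> n \<in> carrier N \<Longrightarrow>
      f (pure_tensor M N m n) = g (pure_tensor M N m n)"
  shows "f = g"
proof (rule extensionalityI[of _ "carrier (tensor M N)"])
  interpret T: distributive_module "tensor M N" by (rule distributive_tensor)
  have "f (cls u) = g (cls u)" if "u \<in> carrier F" for u
    using that
  proof (induction rule: free_induct)
    case bottom
    then show ?case using heymod_homD(4)[OF f] heymod_homD(4)[OF g] by (simp add: bottom_tensor)
  next
    case (add u c s)
    then show ?case
      by (cases s) (auto simp: cls_add_term cls_closed pure_tensor_closed T.act_closed eq
          heymod_homD(5,6)[OF f] heymod_homD(5,6)[OF g])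
  qed
  then show "f t = g t" if "t \<in> carrier (tensor M N)" for t
    using that by (auto simp: carrier_tensor)
qed (use f g in \<open>auto dest: heymod_homD\<close>)

section \<open>The unit of the adjunction and currying\<close>

lemma pure_tensor_hom_right:
  assumes "m \<in> carrier M"
  shows "(\<lambda>n\<in>carrier N. pure_tensor M N m n) \<in> heymod_hom N (tensor M N)"
  using assms
  by (intro heymod_homI) (auto simp: pure_tensor_closed N.bottom_closed N.join_closed N.act_closed
      pure_tensor_bottom_right pure_tensor_join_right pure_tensor_act_right)

text \<open>This morphism is the unit of the adjunction at \<open>M\<close>.\<close>

lemma pure_tensor_hom:
  "(\<lambda>m\<in>carrier M. \<lambda>n\<in>carrier N. pure_tensor M N m n) \<in> heymod_hom M (hom_module N (tensor M N))"
  by (intro heymod_homI) (auto simp: pure_tensor_hom_right M.bottom_closed M.join_closed M.act_closed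
      pure_tensor_bottom_left pure_tensor_join_left pure_tensor_act_left intro!: restrict_ext)

lemma tensor_curry_apply:
  "m \<in> carrier M \<Longrightarrow> n \<in> carrier N \<Longrightarrow> tensor_curry M N f m n = f (pure_tensor M N m n)"
  by (simp add: tensor_curry_def)

text \<open>The transpose of \<open>f\<close> is \<open>f\<close> applied by postcomposition after
  the unit, so that it is a morphism follows from closure under composition.\<close>

lemma tensor_curry_eq_compose:
  "tensor_curry M N f = compose (carrier M) (hom_map N (tensor M N) f)
     (\<lambda>m\<in>carrier M. \<lambda>n\<in>carrier N. pure_tensor M N m n)"
  by (auto simp: tensor_curry_def compose_def hom_map_apply pure_tensor_hom_right intro!: restrict_ext)

lemma tensor_curry_hom:
  assumes "f \<in> heymod_hom (tensor M N) P"
  shows "tensor_curry M N f \<in> heymod_hom M (hom_module N P)"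
  unfolding tensor_curry_eq_compose
  by (rule heymod_hom_compose[OF M.distributive_module_axioms pure_tensor_hom
        hom_map_hom[OF N.distributive_module_axioms distributive_tensor assms]])

end

section \<open>Uncurrying\<close>

text \<open>Collecting the terms in a set may identify some of them, which does no harm because
  joins are idempotent. The choice is unambiguous in a join semilattice, by antisymmetry.\<close>

definition free_ext :: "('h :: bounded_lattice, 'p) hmod \<Rightarrow> ('m \<Rightarrow> 'n \<Rightarrow> 'p) \<Rightarrow> ('m \<times> 'n \<Rightarrow> 'h) \<Rightarrow> 'p"
  where "free_ext P b u =
    (SOME p. is_join P ((\<lambda>s. act P (u s) (b (fst s) (snd s))) ` {s. u s \<noteq> bot}) p)"

text \<open>A class is evaluated at an arbitrary representative; \<open>free_ext_step\<close> makes
  the value independent of it. The restriction provides the extensionality that morphisms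
  require.\<close>

definition tensor_uncurry ::
  "('h :: bounded_lattice, 'm) hmod \<Rightarrow> ('h, 'n) hmod \<Rightarrow> ('h, 'p) hmod \<Rightarrow> ('m \<Rightarrow> 'n \<Rightarrow> 'p) \<Rightarrow>
   ('m \<times> 'n \<Rightarrow> 'h) set \<Rightarrow> 'p"
  where "tensor_uncurry M N P b = (\<lambda>X\<in>carrier (tensor M N). free_ext P b (SOME u. u \<in> X))"

text \<open>Here \<open>b\<close> is a bilinear map in curried form: its values are linear in
  \<open>n\<close> (\<open>b_right\<close>), and \<open>b\<close> itself is linear in
  \<open>m\<close> (\<open>b_left\<close>).\<close>

locale bimorphism = module_pair M N + P: distributive_module P
  for M :: "('h :: {distrib_lattice, bounded_lattice}, 'm) hmod" and N :: "('h, 'n) hmod"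
    and P :: "('h, 'p) hmod" +
  fixes b :: "'m \<Rightarrow> 'n \<Rightarrow> 'p"
  assumes hom: "b \<in> heymod_hom M (hom_module N P)"
begin

lemma b_hom: "m \<in> carrier M \<Longrightarrow> b m \<in> heymod_hom N P"
  using heymod_homD(3)[OF hom] by simp

lemmas b_right = heymod_homD(3-6)[OF b_hom]

lemma b_left:
  "n \<in> carrier N \<Longrightarrow> b (bottom M) n = bottom P"
  "\<lbrakk>m \<in> carrier M; m' \<in> carrier M; n \<in> carrier N\<rbrakk> \<Longrightarrow> b (join M m m') n = join P (b m n) (b m' n)"
  "\<lbrakk>m \<in> carrier M; n \<in> carrier N\<rbrakk> \<Longrightarrow> b (act M x m) n = act P x (b m n)"
  by (simp_all add: heymod_homD[OF hom])

section \<open>Extension of a bilinear map to formal sums\<close>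

lemma free_ext_is_join:
  assumes "u \<in> carrier F"
  shows "is_join P ((\<lambda>s. act P (u s) (b (fst s) (snd s))) ` {s. u s \<noteq> bot}) (free_ext P b u)"
  unfolding free_ext_def
proof (rule someI_ex, rule P.finite_joins)
  show "(\<lambda>s. act P (u s) (b (fst s) (snd s))) ` {s. u s \<noteq> bot} \<subseteq> carrier P"
    using assms by (auto simp: free_carrier_iff b_right intro!: P.act_closed)
qed (use assms in \<open>simp add: free_carrier_iff\<close>)

lemma free_ext_closed: "u \<in> carrier F \<Longrightarrow> free_ext P b u \<in> carrier P"
  using free_ext_is_join by (simp add: is_join_def)

text \<open>Outside the support the coefficient \<open>bot\<close> yields the bottom element, which
  lies below every \<open>t\<close>. Quantifying over all pairs spares later proofs from computing
  the support of a join or a single term.\<close>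

lemma free_ext_le_iff:
  assumes u: "u \<in> carrier F" and t: "t \<in> carrier P"
  shows "mod_le P (free_ext P b u) t \<longleftrightarrow>
    (\<forall>m\<in>carrier M. \<forall>n\<in>carrier N. mod_le P (act P (u (m, n)) (b m n)) t)"
proof
  have "{s. u s \<noteq> bot} \<subseteq> carrier M \<times> carrier N" using u by (simp add: free_carrier_iff)
  moreover assume "\<forall>m\<in>carrier M. \<forall>n\<in>carrier N. mod_le P (act P (u (m, n)) (b m n)) t"
  ultimately show "mod_le P (free_ext P b u) t"
    using free_ext_is_join[OF u] t unfolding is_join_def by fastforce
next
  assume le: "mod_le P (free_ext P b u) t"
  show "\<forall>m\<in>carrier M. \<forall>n\<in>carrier N. mod_le P (act P (u (m, n)) (b m n)) t"
  proof (intro ballI)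
    fix m n assume mn: "m \<in> carrier M" "n \<in> carrier N"
    show "mod_le P (act P (u (m, n)) (b m n)) t"
    proof (cases "u (m, n) = bot")
      case True
      then show ?thesis using mn t by (simp add: P.act_bot P.bottom_le b_right)
    next
      case False
      then have "mod_le P (act P (u (m, n)) (b m n)) (free_ext P b u)"
        using free_ext_is_join[OF u] unfolding is_join_def by fastforce
      then show ?thesis
        using P.le_trans[OF P.act_closed[OF b_right(1)[OF mn]] free_ext_closed[OF u] t _ le] by blast
    qed
  qed
qed

lemma free_ext_bottom: "free_ext P b (\<lambda>s. bot) = bottom P"
  by (rule P.eq_iff_upper_bounds)
    (auto simp: free_ext_closed free_bottom_closed P.bottom_closed P.bottom_le free_ext_le_iff
      P.act_bot b_right)

lemma free_ext_join:
  assumes "u \<in> carrier F" "v \<in> carrier F"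
  shows "free_ext P b (\<lambda>s. sup (u s) (v s)) = join P (free_ext P b u) (free_ext P b v)"
  by (rule P.eq_iff_upper_bounds)
    (auto simp: assms free_ext_closed free_join_closed P.join_closed P.join_le_iff free_ext_le_iff
      P.act_sup P.act_closed b_right)

lemma free_ext_single:
  assumes "m \<in> carrier M" "n \<in> carrier N"
  shows "free_ext P b (free_single c (m, n)) = act P c (b m n)"
proof (rule P.eq_iff_upper_bounds)
  fix t assume "t \<in> carrier P"
  then show "mod_le P (free_ext P b (free_single c (m, n))) t \<longleftrightarrow> mod_le P (act P c (b m n)) t"
    using assms
    by (simp add: free_ext_le_iff free_single_closed)
      (auto simp: free_single_def P.act_bot P.bottom_le b_right)
qed (use assms in \<open>auto simp: free_ext_closed free_single_closed P.act_closed b_right\<close>)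

lemma free_ext_add_term:
  assumes "u \<in> carrier F" "m \<in> carrier M" "n \<in> carrier N"
  shows "free_ext P b (add_term u c (m, n)) = join P (free_ext P b u) (act P c (b m n))"
  using assms unfolding add_term_def by (simp add: free_ext_join free_ext_single free_single_closed)

lemma free_ext_act:
  assumes "u \<in> carrier F"
  shows "free_ext P b (\<lambda>s. inf c (u s)) = act P c (free_ext P b u)"
  using assms
proof (induction rule: free_induct)
  case bottom
  then show ?case by (simp add: free_ext_bottom P.act_bottom)
next
  case (add u d s)
  then show ?case
    by (cases s) (auto simp: add_term_act free_ext_add_term free_act_closed free_ext_closed
        P.act_join P.act_inf P.act_closed b_right)
qed

text \<open>Once \<open>free_ext_add_term\<close> has split off the value at \<open>u\<close>, what
  remains of each relation is linearity of \<open>b\<close> in one variable, combined with the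
  module laws of \<open>P\<close>.\<close>

lemma free_ext_step:
  assumes "tensor_step M N u v"
  shows "free_ext P b u = free_ext P b v"
  using assms
proof cases
  case (bottom_left n c)
  then show ?thesis
    by (simp add: free_ext_add_term M.bottom_closed b_left P.act_bottom P.bottom_closed
        free_ext_closed P.join_commute[of _ "bottom P"] P.join_bottom_left)
next
  case (bottom_right m c)
  then show ?thesis
    by (simp add: free_ext_add_term N.bottom_closed b_right P.act_bottom P.bottom_closed
        free_ext_closed P.join_commute[of _ "bottom P"] P.join_bottom_left)
qed (simp_all add: free_ext_add_term add_term_closed M.join_closed N.join_closed M.act_closed
    N.act_closed b_left b_right P.act_join P.act_inf P.act_closed free_ext_closed P.join_assoc)

section \<open>Descent to the tensor product\<close>

lemma tensor_uncurry_cls: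
  assumes "u \<in> carrier F"
  shows "tensor_uncurry M N P b (cls u) = free_ext P b u"
proof -
  have "(SOME v. v \<in> cls u) \<in> cls u"
    by (rule someI[of "\<lambda>v. v \<in> cls u", OF mem_cls_self[OF assms]])
  then show ?thesis
    using assms equivclp_invariant[of "tensor_step M N" u _ "free_ext P b"] free_ext_step
    by (auto simp: tensor_uncurry_def cls_closed dest!: mem_clsD)
qed

lemma tensor_uncurry_hom: "tensor_uncurry M N P b \<in> heymod_hom (tensor M N) P"
proof (rule heymod_homI)
  show "tensor_uncurry M N P b \<in> carrier (tensor M N) \<rightarrow>\<^sub>E carrier P"
  proof
    show "tensor_uncurry M N P b X \<in> carrier P" if "X \<in> carrier (tensor M N)" for X
      using that by (auto simp: carrier_tensor tensor_uncurry_cls free_ext_closed)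
  qed (simp add: tensor_uncurry_def)
qed (auto simp: carrier_tensor bottom_tensor join_cls act_cls tensor_uncurry_cls free_bottom_closed
    free_join_closed free_act_closed free_ext_bottom free_ext_join free_ext_act)

lemma tensor_uncurry_pure:
  assumes "m \<in> carrier M" "n \<in> carrier N"
  shows "tensor_uncurry M N P b (pure_tensor M N m n) = b m n"
  using assms unfolding pure_tensor_def
  by (simp add: tensor_uncurry_cls free_single_closed free_ext_single P.act_top b_right)

lemma tensor_curry_uncurry: "tensor_curry M N (tensor_uncurry M N P b) = b"
proof (rule extensionalityI[of _ "carrier M"])
  fix m assume m: "m \<in> carrier M"
  show "tensor_curry M N (tensor_uncurry M N P b) m = b m"
    using m heymod_homD(2)[OF b_hom[OF m]]
    by (intro extensionalityI[of _ "carrier N"])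
      (auto simp: tensor_uncurry_pure tensor_curry_def)
qed (use heymod_homD(2)[OF hom] in \<open>auto simp: tensor_curry_def\<close>)

end

lemma bij_tensor_curry:
  assumes "distributive_module M" "distributive_module N" "distributive_module P"
  shows "bij_betw (tensor_curry M N) (heymod_hom (tensor M N) P) (heymod_hom M (hom_module N P))"
proof -
  interpret module_pair M N by (intro module_pair.intro assms)
  have bi: "bimorphism M N P b" if "b \<in> heymod_hom M (hom_module N P)" for b
    using that assms by (intro bimorphism.intro module_pair.intro bimorphism_axioms.intro)
  show ?thesis
  proof (rule bij_betw_imageI)
    show "inj_on (tensor_curry M N) (heymod_hom (tensor M N) P)"
      \<comment> \<open>Equal curried maps, evaluated at \<open>m\<close> and \<open>n\<close>, give
        equal values on pure tensors.\<close>
      by (intro inj_onI tensor_hom_eqI) (auto dest: fun_cong simp flip: tensor_curry_apply)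
    show "tensor_curry M N ` heymod_hom (tensor M N) P = heymod_hom M (hom_module N P)"
    proof
      show "heymod_hom M (hom_module N P) \<subseteq> tensor_curry M N ` heymod_hom (tensor M N) P"
        using bimorphism.tensor_uncurry_hom[OF bi] bimorphism.tensor_curry_uncurry[OF bi]
        by (metis image_eqI subsetI)
    qed (auto intro: tensor_curry_hom)
  qed
qed

section \<open>Functoriality of the tensor product\<close>

lemma tensor_map_exists:
  assumes "distributive_module M" "distributive_module M'" "distributive_module N"
    and g: "g \<in> heymod_hom M M'"
  shows "\<exists>h. h \<in> heymod_hom (tensor M N) (tensor M' N) \<and>
    (\<forall>m\<in>carrier M. \<forall>n\<in>carrier N. h (pure_tensor M N m n) = pure_tensor M' N (g m) n)"
proof -
  interpret M: module_pair M N by (intro module_pair.intro assms)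
  interpret M': module_pair M' N by (intro module_pair.intro assms)
  \<comment> \<open>The bilinear map sending \<open>m\<close> and \<open>n\<close> to the tensor of
    \<open>g m\<close> with \<open>n\<close>, obtained as the unit at \<open>M'\<close> after
    \<open>g\<close>; uncurrying it gives the induced morphism.\<close>
  let ?b = "compose (carrier M) (\<lambda>m\<in>carrier M'. \<lambda>n\<in>carrier N. pure_tensor M' N m n) g"
  interpret B: bimorphism M N "tensor M' N" ?b
    using M'.distributive_tensor heymod_hom_compose[OF assms(1) g M'.pure_tensor_hom]
    by (intro bimorphism.intro bimorphism_axioms.intro M.module_pair_axioms)
  show ?thesis
    using B.tensor_uncurry_hom B.tensor_uncurry_pure heymod_homD(3)[OF g]
    by (auto simp: compose_def intro!: exI[of _ "tensor_uncurry M N (tensor M' N) ?b"])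
qed

text \<open>Morphisms out of a tensor product are determined by pure tensors, so the definite
  description in \<open>tensor_map\<close> has at most one solution and any solution
  \<open>h\<close> is its value.\<close>

lemma tensor_map_eqI:
  assumes "distributive_module M" "distributive_module N"
    and h: "h \<in> heymod_hom (tensor M N) (tensor M' N)"
    and pure: "\<And>m n. m \<in> carrier M \<Longrightarrow> n \<in> carrier N \<Longrightarrow>
      h (pure_tensor M N m n) = pure_tensor M' N (g m) n"
  shows "tensor_map N M M' g = h"
proof -
  interpret module_pair M N by (intro module_pair.intro assms)
  show ?thesis
    unfolding tensor_map_def
    by (rule the_equality) (use h pure in \<open>auto intro: tensor_hom_eqI\<close>)
qed

lemma
  assumes "distributive_module M" "distributive_module M'" "distributive_module N"
    and "g \<in> heymod_hom M M'"
  shows tensor_map_hom: "tensor_map N M M' g \<in> heymod_hom (tensor M N) (tensor M' N)"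
    and tensor_map_pure: "m \<in> carrier M \<Longrightarrow> n \<in> carrier N \<Longrightarrow>
      tensor_map N M M' g (pure_tensor M N m n) = pure_tensor M' N (g m) n"
  using tensor_map_exists[OF assms] tensor_map_eqI[OF assms(1,3)] by metis+

lemma tensor_map_id:
  assumes "distributive_module M" "distributive_module N"
  shows "tensor_map N M M (\<lambda>m\<in>carrier M. m) = (\<lambda>t\<in>carrier (tensor M N). t)"
proof -
  interpret module_pair M N by (intro module_pair.intro assms)
  show ?thesis
    by (rule tensor_map_eqI[OF assms])
      (auto simp: pure_tensor_closed heymod_hom_id distributive_tensor)
qed

lemma tensor_map_compose:
  assumes "distributive_module M1" "distributive_module M2" "distributive_module M3"
    "distributive_module N" and g: "g \<in> heymod_hom M1 M2" and h: "h \<in> heymod_hom M2 M3"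
  shows "tensor_map N M1 M3 (compose (carrier M1) h g) =
    compose (carrier (tensor M1 N)) (tensor_map N M2 M3 h) (tensor_map N M1 M2 g)"
proof -
  interpret module_pair M1 N by (intro module_pair.intro assms)
  show ?thesis
  proof (rule tensor_map_eqI[OF assms(1,4)])
    show "compose (carrier (tensor M1 N)) (tensor_map N M2 M3 h) (tensor_map N M1 M2 g)
        \<in> heymod_hom (tensor M1 N) (tensor M3 N)"
      using assms
      by (intro heymod_hom_compose[OF distributive_tensor tensor_map_hom tensor_map_hom])
  qed (simp add: compose_eq pure_tensor_closed tensor_map_pure assms heymod_homD[OF g])
qed

lemma tensor_curry_natural:
  assumes "distributive_module M1" "distributive_module M2" "distributive_module N"
    and g: "g \<in> heymod_hom M1 M2" and f: "f \<in> heymod_hom (tensor M2 N) P1"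
  shows "tensor_curry M1 N
      (compose (carrier (tensor M1 N)) h
        (compose (carrier (tensor M1 N)) f (tensor_map N M1 M2 g))) =
    compose (carrier M1) (hom_map N P1 h)
      (compose (carrier M1) (tensor_curry M2 N f) g)"
proof -
  interpret M1: module_pair M1 N by (intro module_pair.intro assms)
  interpret M2: module_pair M2 N by (intro module_pair.intro assms)
  \<comment> \<open>\<open>hom_map\<close> is restricted to morphisms, so it can be evaluated only
    once its argument is known to be one. At \<open>m\<close> and \<open>n\<close> both sides then
    become \<open>h\<close> of \<open>f\<close> of the tensor of \<open>g m\<close> with
    \<open>n\<close>.\<close>
  have "tensor_curry M2 N f (g m) \<in> heymod_hom N P1" if "m \<in> carrier M1" for m
    using heymod_homD(3)[OF M2.tensor_curry_hom[OF f]] heymod_homD(3)[OF g that] by simp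
  then show ?thesis
    using heymod_homD(3)[OF g]
    unfolding tensor_curry_def[of M1]
    by (auto simp: compose_def hom_map_apply M1.pure_tensor_closed tensor_map_pure[OF assms(1-4)]
        M2.tensor_curry_apply intro!: restrict_ext)
qed

theorem proposition6p4:
  fixes N :: "('h :: {finite, heyting_algebra}, 'n) hmod"
  assumes "heyting_module N"
  shows
    \<comment> \<open>tensoring with \<open>N\<close> is a functor\<close>
    "(\<forall>M :: ('h, 'm1) hmod. heyting_module M \<longrightarrow> heyting_module (tensor M N)) \<and>
     (\<forall>(M1 :: ('h, 'm1) hmod) (M2 :: ('h, 'm2) hmod) g.
        heyting_module M1 \<and> heyting_module M2 \<and> g \<in> heymod_hom M1 M2 \<longrightarrow>
        tensor_map N M1 M2 g \<in> heymod_hom (tensor M1 N) (tensor M2 N) \<and>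
        (\<forall>m\<in>carrier M1. \<forall>n\<in>carrier N.
           tensor_map N M1 M2 g (pure_tensor M1 N m n) = pure_tensor M2 N (g m) n)) \<and>
     (\<forall>M :: ('h, 'm1) hmod. heyting_module M \<longrightarrow>
        tensor_map N M M (\<lambda>m\<in>carrier M. m) = (\<lambda>t\<in>carrier (tensor M N). t)) \<and>
     (\<forall>(M1 :: ('h, 'm1) hmod) (M2 :: ('h, 'm2) hmod) (M3 :: ('h, 'm3) hmod) g h.
        heyting_module M1 \<and> heyting_module M2 \<and> heyting_module M3 \<and>
        g \<in> heymod_hom M1 M2 \<and> h \<in> heymod_hom M2 M3 \<longrightarrow>
        tensor_map N M1 M3 (compose (carrier M1) h g) =
        compose (carrier (tensor M1 N)) (tensor_map N M2 M3 h) (tensor_map N M1 M2 g)) \<and>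
     \<comment> \<open>morphisms out of \<open>N\<close> form a functor\<close>
     (\<forall>P :: ('h, 'p1) hmod. heyting_module P \<longrightarrow> heyting_module (hom_module N P)) \<and>
     (\<forall>(P1 :: ('h, 'p1) hmod) (P2 :: ('h, 'p2) hmod) g.
        heyting_module P1 \<and> heyting_module P2 \<and> g \<in> heymod_hom P1 P2 \<longrightarrow>
        hom_map N P1 g \<in> heymod_hom (hom_module N P1) (hom_module N P2)) \<and>
     (\<forall>P :: ('h, 'p1) hmod. heyting_module P \<longrightarrow>
        hom_map N P (\<lambda>p\<in>carrier P. p) = (\<lambda>f\<in>carrier (hom_module N P). f)) \<and>
     (\<forall>(P1 :: ('h, 'p1) hmod) (P2 :: ('h, 'p2) hmod) (P3 :: ('h, 'p3) hmod) g h.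
        heyting_module P1 \<and> heyting_module P2 \<and> heyting_module P3 \<and>
        g \<in> heymod_hom P1 P2 \<and> h \<in> heymod_hom P2 P3 \<longrightarrow>
        hom_map N P1 (compose (carrier P1) h g) =
        compose (carrier (hom_module N P1)) (hom_map N P2 h) (hom_map N P1 g)) \<and>
     \<comment> \<open>currying is a bijection of hom-sets, natural in both arguments\<close>
     (\<forall>(M :: ('h, 'm1) hmod) (P :: ('h, 'p1) hmod).
        heyting_module M \<and> heyting_module P \<longrightarrow>
        bij_betw (tensor_curry M N)
          (heymod_hom (tensor M N) P) (heymod_hom M (hom_module N P))) \<and>
     (\<forall>(M1 :: ('h, 'm1) hmod) (M2 :: ('h, 'm2) hmod) (P1 :: ('h, 'p1) hmod) (P2 :: ('h, 'p2) hmod) g h f.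
        heyting_module M1 \<and> heyting_module M2 \<and> heyting_module P1 \<and> heyting_module P2 \<and>
        g \<in> heymod_hom M1 M2 \<and> h \<in> heymod_hom P1 P2 \<and> f \<in> heymod_hom (tensor M2 N) P1 \<longrightarrow>
        tensor_curry M1 N
          (compose (carrier (tensor M1 N)) h
            (compose (carrier (tensor M1 N)) f (tensor_map N M1 M2 g))) =
        compose (carrier M1) (hom_map N P1 h)
          (compose (carrier M1) (tensor_curry M2 N f) g))"
proof -
  have N: "distributive_module N" using assms by (simp add: heyting_module_def)
  have tensor: "heyting_module (tensor M N)" if "heyting_module M" for M :: "('h, 'x) hmod"
    using that N
    by (intro finite_heyting_module module_pair.distributive_tensor module_pair.intro)
      (simp_all add: heyting_module_def)
  have hom: "heyting_module (hom_module N P)" if "heyting_module P" for P :: "('h, 'x) hmod"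
    using that N
    by (intro finite_heyting_module distributive_hom_module) (simp_all add: heyting_module_def)
  show ?thesis
    by (intro conjI allI impI ballI; (elim conjE)?)
      (simp_all add: tensor hom heyting_module.axioms(1) N tensor_map_hom tensor_map_pure
        tensor_map_id tensor_map_compose hom_map_hom hom_map_id[unfolded hom_module_simps]
        hom_map_compose[unfolded hom_module_simps] bij_tensor_curry tensor_curry_natural)
qed

end
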